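(* Let $K$ be a field and let $A=(F/K,z,u,b)$ be a bicyclic $K$-algebra, with associated data $\sigma_1,\sigma_2,n_1,n_2,F_1,F_2,N_1,N_2,b_1,b_2,u$ as in the context. Consider the system of equations $$N_1(x_1)=b_1,\qquad N_2(x_2)=b_2,\qquad \frac{\sigma_2(x_1)}{x_1}\cdot\frac{x_2}{\sigma_1(x_2)}=u \qquad ( * )$$ in unknowns $x_1,x_2\in F^*$, and the following procedure: Step 1. Solve $N_1(x_1)=b_1$ for $x_1\in F^*$. Step 2. Solve $\dfrac{\sigma_1(x_2')}{x_2'}=u\,\dfrac{x_1}{\sigma_2(x_1)}$ for $x_2'\in F^*$. Step 3. Solve $N_2(x_2'')=b_2N_2(x_2')$ for $x_2''\in F_1^*$. Step 4. Define $x_2:=x_2'^{-1}x_2''$. Then the procedure is correct in the following sense. If $( * )$ has a solution in $F^*\times F^*$, then each of Steps 1, 2, 3 has a solution (whatever solutions were chosen in the preceding steps), and the resulting pair $(x_1,x_2)$ is a solution of $( * )$. Conversely, if all steps have a solution, then the resulting pair $(x_1,x_2)$ is a solution of $( * )$.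
   Context: All algebras are finite-dimensional. A central-simple $K$-algebra $A$ is a $K$-algebra without proper two-sided ideals and with center $K$; its degree is $\sqrt{\dim_K A}$; a maximal subfield is a commutative subfield $F\supseteq K$ with $[F:K]=\deg A$. $A$ is bicyclic if it contains a maximal subfield $F$ that is Galois over $K$ with $G=\mathrm{Gal}(F/K)=G_1\times G_2$, $G_i=\langle\sigma_i\rangle$ cyclic of order $n_i$. Let $F_i$ be the fixed field of $\sigma_i$ in $F$ and let $N_i=N_{F/F_i}:F\to F_i$ be the norm map. By the Skolem-Noether theorem there are $z_1,z_2\in A^*$ with $z_ixz_i^{-1}=\sigma_i(x)$ for all $x\in F$, and then $A=\bigoplus_{i=0}^{n_1-1}\bigoplus_{j=0}^{n_2-1}Fz_1^iz_2^j$. Put $b_1:=z_1^{n_1}$, $b_2:=z_2^{n_2}$, $u:=z_2z_1z_2^{-1}z_1^{-1}$; these are elements of $F^*$. One writes $A=(F/K,z,u,b)$ with $z=(z_1,z_2)$, $b=(b_1,b_2)$. The elements satisfy $$N_1(u)=\frac{\sigma_2(b_1)}{b_1},\qquad N_2(u)=\frac{b_2}{\sigma_1(b_2)},\qquad b_i\in F_i,$$ and conversely any $b_1,b_2,u\in F^*$ satisfying these relations define a bicyclic algebra in this way. *)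

theory Defs
  imports "HOL-Algebra.Algebra" Complex_Main
begin

text \<open>
  Algebras over a field K are rings A (in the sense of HOL-Algebra) with K a subfield of the
  carrier; the structure map K \<rightarrow> A of a nonzero algebra is injective, so K is identified with its
  image. Subfields F of A are carrier subsets, regarded as rings by restricting the carrier of A.
\<close>

definition ring_center :: "('a, 'b) ring_scheme \<Rightarrow> 'a set" where
  "ring_center A = {a \<in> carrier A. \<forall>x \<in> carrier A. a \<otimes>\<^bsub>A\<^esub> x = x \<otimes>\<^bsub>A\<^esub> a}"

definition simple_ring :: "('a, 'b) ring_scheme \<Rightarrow> bool" where
  "simple_ring A \<longleftrightarrow> ring A \<and> carrier A \<noteq> {\<zero>\<^bsub>A\<^esub>} \<and>
     (\<forall>I. ideal I A \<longrightarrow> I = {\<zero>\<^bsub>A\<^esub>} \<or> I = carrier A)"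

definition central_simple_algebra :: "'a set \<Rightarrow> ('a, 'b) ring_scheme \<Rightarrow> bool" where
  "central_simple_algebra K A \<longleftrightarrow>
     simple_ring A \<and> subfield K A \<and> ring_center A = K \<and> ring.finite_dimension A K (carrier A)"

definition algebra_degree :: "'a set \<Rightarrow> ('a, 'b) ring_scheme \<Rightarrow> real" where
  "algebra_degree K A = sqrt (real (ring.dim A K (carrier A)))"

text \<open>
  In \<^term>\<open>maximal_subfield\<close>, finite dimension of F is stated explicitly because
  \<^term>\<open>ring.dim\<close> is unspecified on infinite-dimensional subspaces.
\<close>

definition maximal_subfield :: "'a set \<Rightarrow> 'a set \<Rightarrow> ('a, 'b) ring_scheme \<Rightarrow> bool" where
  "maximal_subfield K F A \<longleftrightarrow> subfield F A \<and> K \<subseteq> F \<and> ring.finite_dimension A K F \<and>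
     real (ring.dim A K F) = algebra_degree K A"

definition fixed_field :: "'a set \<Rightarrow> ('a \<Rightarrow> 'a) set \<Rightarrow> 'a set" where
  "fixed_field F S = {x \<in> F. \<forall>\<sigma> \<in> S. \<sigma> x = x}"

text \<open>
  The group Aut(F/E) of ring automorphisms of F that fix E pointwise, under composition. As in
  \<^term>\<open>BijGroup\<close>, automorphisms are extensional functions, so that they are determined by
  their values on F.
\<close>

definition gal_group :: "('a, 'b) ring_scheme \<Rightarrow> 'a set \<Rightarrow> 'a set \<Rightarrow> ('a \<Rightarrow> 'a) monoid" where
  "gal_group A F E = (BijGroup F)\<lparr>carrier :=
     {\<sigma> \<in> Bij F. \<sigma> \<in> ring_iso (A\<lparr>carrier := F\<rparr>) (A\<lparr>carrier := F\<rparr>) \<and> (\<forall>x \<in> E. \<sigma> x = x)}\<rparr>"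

definition galois_extension :: "('a, 'b) ring_scheme \<Rightarrow> 'a set \<Rightarrow> 'a set \<Rightarrow> bool" where
  "galois_extension A F K \<longleftrightarrow> subfield F A \<and> subfield K A \<and> K \<subseteq> F \<and>
     ring.finite_dimension A K F \<and> fixed_field F (carrier (gal_group A F K)) = K"

text \<open>
  The norm of a finite Galois extension F/E, as the product of all Galois conjugates. The product
  is taken in F, which unlike A is commutative.
\<close>

definition galois_norm :: "('a, 'b) ring_scheme \<Rightarrow> 'a set \<Rightarrow> 'a set \<Rightarrow> 'a \<Rightarrow> 'a" where
  "galois_norm A F E x =
     finprod (A\<lparr>carrier := F\<rparr>) (\<lambda>\<sigma>. \<sigma> x) (carrier (gal_group A F E))"

definition internal_direct_product ::
    "('g, 'b) monoid_scheme \<Rightarrow> 'g set \<Rightarrow> 'g set \<Rightarrow> bool" where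
  "internal_direct_product G H1 H2 \<longleftrightarrow> subgroup H1 G \<and> subgroup H2 G \<and>
     (\<lambda>(g, h). g \<otimes>\<^bsub>G\<^esub> h) \<in> iso (G\<lparr>carrier := H1\<rparr> \<times>\<times> G\<lparr>carrier := H2\<rparr>) G"

text \<open>
  The data A = (F/K, z, u, b) of a bicyclic algebra. That u, b1, b2 lie in F, the relations between
  them, and the decomposition of A as a direct sum of the F z1^i z2^j are consequences
  and therefore not assumed.
\<close>

locale bicyclic_algebra =
  fixes A :: "('a, 'b) ring_scheme" (structure)
    and K F :: "'a set"
    and \<sigma>1 \<sigma>2 :: "'a \<Rightarrow> 'a"
    and n1 n2 :: nat
    and z1 z2 u b1 b2 :: 'a
  assumes csa: "central_simple_algebra K A"
    and max_subfield: "maximal_subfield K F A"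
    and galois: "galois_extension A F K"
    and \<sigma>1_gal: "\<sigma>1 \<in> carrier (gal_group A F K)"
    and \<sigma>2_gal: "\<sigma>2 \<in> carrier (gal_group A F K)"
    and direct_product: "internal_direct_product (gal_group A F K)
          (generate (gal_group A F K) {\<sigma>1}) (generate (gal_group A F K) {\<sigma>2})"
    and n1_pos: "0 < n1" and n1_card: "card (generate (gal_group A F K) {\<sigma>1}) = n1"
    and n2_pos: "0 < n2" and n2_card: "card (generate (gal_group A F K) {\<sigma>2}) = n2"
    and z1_unit: "z1 \<in> Units A" and z2_unit: "z2 \<in> Units A"
    and z1_conj: "\<And>x. x \<in> F \<Longrightarrow> z1 \<otimes> x \<otimes> inv z1 = \<sigma>1 x"
    and z2_conj: "\<And>x. x \<in> F \<Longrightarrow> z2 \<otimes> x \<otimes> inv z2 = \<sigma>2 x"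
    and u_eq: "u = z2 \<otimes> z1 \<otimes> inv z2 \<otimes> inv z1"
    and b1_eq: "b1 = z1 [^] n1" and b2_eq: "b2 = z2 [^] n2"

end

(*
  Two solutions of N1(x1) = b1 differ by an element of norm 1, hence by a quotient w / s1(w) by
  Hilbert 90. Replacing y1 by y1 * s1(w) / w and y2 by y2 * s2(w) / w changes neither N2(y2)
  nor the third equation, so a solution of the system exists for every choice in Step 1; two choices in
  Step 2 then differ by an element fixed by s1, which Step 3 absorbs. That u and b2 lie in F is
  read off the equations of Steps 2 and 3.

  The norm N1 runs over Gal(F/F1), whereas Hilbert 90 needs a generator, so Gal(F/F1) = <s1> has
  to be known (Artin): if g lies outside a finite group H of automorphisms but fixes its fixed
  field, then g fixes the trace of H, which is a linear relation between the elements of H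
  and gH. Dedekind's independence of automorphisms excludes this and also gives Hilbert 90.
*)

theory Submission
  imports Defs
begin

section \<open>Independence of ring homomorphisms\<close>

text \<open>Dedekind's argument: two relations are combined so that the term of one homomorphism
  cancels, and induction applies to the rest. The family is indexed and its members need to differ
  only on the carrier, so that composites which are not extensional can occur in it.\<close>

lemma (in domain) dedekind_independence:
  assumes "finite S"
    and "\<And>i. i \<in> S \<Longrightarrow> f i \<in> ring_hom R R"
    and "\<And>i j. i \<in> S \<Longrightarrow> j \<in> S \<Longrightarrow> i \<noteq> j \<Longrightarrow> \<exists>x \<in> carrier R. f i x \<noteq> f j x"
    and "c \<in> S \<rightarrow> carrier R"
    and "\<And>x. x \<in> carrier R \<Longrightarrow> (\<Oplus>i\<in>S. c i \<otimes> f i x) = \<zero>"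
    and "i \<in> S"
  shows "c i = \<zero>"
  using assms
proof (induction S arbitrary: c i rule: finite_induct)
  case empty
  then show ?case by simp
next
  case (insert j S)
  have hom: "f k \<in> ring_hom R R" if "k \<in> insert j S" for k
    using insert.prems(1) that by blast
  have fc: "f k x \<in> carrier R" if "k \<in> insert j S" "x \<in> carrier R" for k x
    using ring_hom_closed[OF hom] that by blast
  have c: "c k \<in> carrier R" if "k \<in> insert j S" for k
    using insert.prems(3) that by blast
  have sum: "(\<Oplus>i\<in>S. c i \<otimes> f i x) = \<ominus> (c j \<otimes> f j x)" if x: "x \<in> carrier R" for x
  proof -
    have "(\<Oplus>i\<in>insert j S. c i \<otimes> f i x) = c j \<otimes> f j x \<oplus> (\<Oplus>i\<in>S. c i \<otimes> f i x)"
      using insert.hyps c fc x by (intro finsum_insert) auto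
    then have "c j \<otimes> f j x \<oplus> (\<Oplus>i\<in>S. c i \<otimes> f i x) = \<zero>"
      using insert.prems(4) x by simp
    moreover have "(\<Oplus>i\<in>S. c i \<otimes> f i x) \<in> carrier R"
      using c fc x by (intro finsum_closed) auto
    ultimately show ?thesis
      using c fc x by (metis a_comm insertI1 m_closed minus_equality)
  qed
  have IH: "d k = \<zero>" if "d \<in> S \<rightarrow> carrier R" "k \<in> S"
    "\<And>x. x \<in> carrier R \<Longrightarrow> (\<Oplus>i\<in>S. d i \<otimes> f i x) = \<zero>" for d k
    by (rule insert.IH[OF insert.prems(1,2) that(1,3,2)]) simp_all
  \<comment> \<open>Subtracting \<open>f j y\<close> times the relation at \<open>x\<close> from the
    relation at \<open>y \<otimes> x\<close> removes the term of \<open>j\<close>. What remains is a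
    relation over \<open>S\<close> with the coefficients shown here.\<close>
  have *: "c k \<otimes> (f k y \<ominus> f j y) = \<zero>" if y: "y \<in> carrier R" and k: "k \<in> S" for k y
  proof (rule IH[of "\<lambda>k. c k \<otimes> (f k y \<ominus> f j y)"])
    show "(\<lambda>k. c k \<otimes> (f k y \<ominus> f j y)) \<in> S \<rightarrow> carrier R"
      using c fc y by auto
    fix x assume x: "x \<in> carrier R"
    have "(\<Oplus>i\<in>S. c i \<otimes> (f i y \<ominus> f j y) \<otimes> f i x)
        = (\<Oplus>i\<in>S. c i \<otimes> f i (y \<otimes> x) \<oplus> \<ominus> f j y \<otimes> (c i \<otimes> f i x))"
    proof (intro finsum_cong' refl)
      show "(\<lambda>i. c i \<otimes> f i (y \<otimes> x) \<oplus> \<ominus> f j y \<otimes> (c i \<otimes> f i x)) \<in> S \<rightarrow> carrier R"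
        using c fc x y by auto
      fix i assume i: "i \<in> S"
      have "f i (y \<otimes> x) = f i y \<otimes> f i x"
        using ring_hom_mult[OF hom] i x y by blast
      moreover have "c i \<in> carrier R" "f i y \<in> carrier R" "f i x \<in> carrier R" "f j y \<in> carrier R"
        using c fc x y i by auto
      ultimately show "c i \<otimes> (f i y \<ominus> f j y) \<otimes> f i x
          = c i \<otimes> f i (y \<otimes> x) \<oplus> \<ominus> f j y \<otimes> (c i \<otimes> f i x)"
        by algebra
    qed
    also have "\<dots> = (\<Oplus>i\<in>S. c i \<otimes> f i (y \<otimes> x)) \<oplus> (\<Oplus>i\<in>S. \<ominus> f j y \<otimes> (c i \<otimes> f i x))"
      using c fc x y by (intro finsum_addf) auto
    also have "(\<Oplus>i\<in>S. \<ominus> f j y \<otimes> (c i \<otimes> f i x)) = \<ominus> f j y \<otimes> (\<Oplus>i\<in>S. c i \<otimes> f i x)"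
      using insert.hyps c fc x y by (intro finsum_rdistr[symmetric]) auto
    also have "(\<Oplus>i\<in>S. c i \<otimes> f i (y \<otimes> x)) \<oplus> \<ominus> f j y \<otimes> (\<Oplus>i\<in>S. c i \<otimes> f i x)
        = \<ominus> (c j \<otimes> (f j y \<otimes> f j x)) \<oplus> \<ominus> f j y \<otimes> \<ominus> (c j \<otimes> f j x)"
      using sum x y ring_hom_mult[OF hom[of j]] by simp
    also have "\<dots> = \<zero>"
    proof -
      have "c j \<in> carrier R" "f j y \<in> carrier R" "f j x \<in> carrier R"
        using c fc x y by auto
      then show ?thesis by algebra
    qed
    finally show "(\<Oplus>i\<in>S. c i \<otimes> (f i y \<ominus> f j y) \<otimes> f i x) = \<zero>" .
  qed (rule k)
  have S0: "c k = \<zero>" if k: "k \<in> S" for k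
  proof -
    have "k \<noteq> j"
      using k insert.hyps by blast
    then obtain y where y: "y \<in> carrier R" "f k y \<noteq> f j y"
      using insert.prems(2) k by blast
    then have "f k y \<ominus> f j y \<noteq> \<zero>"
      using fc k by simp
    then show ?thesis
      using *[OF y(1) k] c fc y k by (metis insertCI integral minus_closed)
  qed
  \<comment> \<open>At \<one> every homomorphism has the value \<one>, so the relation reduces to
    its one remaining coefficient \<open>c j\<close>.\<close>
  have "(\<Oplus>i\<in>S. c i \<otimes> f i \<one>) = \<zero>"
    using S0 fc by (intro add.finprod_one_eqI) simp
  then have "c j = \<zero>"
    using sum[of \<one>] ring_hom_one[OF hom[of j]] c[of j] by (metis add.inv_eq_1_iff insertI1 one_closed r_one)
  then show ?case
    using S0 insert.prems(5) by blast
qed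

section \<open>Galois groups as groups of automorphisms of a field\<close>

text \<open>Lets a subfield \<open>F\<close> of the noncommutative \<open>A\<close> be replaced by a
  field whose whole carrier is \<open>F\<close>, the setting of the lemmas that follow.\<close>

lemma gal_group_carrier_update: "gal_group (A\<lparr>carrier := F\<rparr>) F E = gal_group A F E"
  by (simp add: gal_group_def)

text \<open>Composites and inverses in \<open>BijGroup\<close> are restricted to the carrier, so
  they agree with the usual composite or inverse map only there.\<close>

lemma ring_iso_cong:
  assumes g: "g \<in> ring_iso R S" and eq: "\<And>x. x \<in> carrier R \<Longrightarrow> h x = g x"
    and R: "ring R"
  shows "h \<in> ring_iso R S"
proof -
  interpret ring R
    by (rule R)
  have "bij_betw h (carrier R) (carrier S)"
    using g eq by (metis bij_betw_cong ring_iso_memE(5))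
  then show ?thesis
    using g eq by (intro ring_iso_memI) (simp_all add: ring_iso_memE)
qed

context field
begin

lemma carrier_gal_group:
  "g \<in> carrier (gal_group R (carrier R) E) \<longleftrightarrow>
     g \<in> extensional (carrier R) \<and> g \<in> ring_iso R R \<and> (\<forall>x \<in> E. g x = x)"
  by (auto simp: gal_group_def Bij_def ring_iso_def)

lemma gal_group_one: "\<one>\<^bsub>gal_group R (carrier R) E\<^esub> = (\<lambda>x \<in> carrier R. x)"
  by (simp add: gal_group_def BijGroup_def)

lemma gal_group_mult:
  assumes "g \<in> carrier (gal_group R (carrier R) E)" "h \<in> carrier (gal_group R (carrier R) E)"
  shows "g \<otimes>\<^bsub>gal_group R (carrier R) E\<^esub> h = compose (carrier R) g h"
  using assms by (auto simp: gal_group_def BijGroup_def)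

lemma gal_group_mult_apply:
  assumes "g \<in> carrier (gal_group R (carrier R) E)" "h \<in> carrier (gal_group R (carrier R) E)"
    and "x \<in> carrier R"
  shows "(g \<otimes>\<^bsub>gal_group R (carrier R) E\<^esub> h) x = g (h x)"
  using assms by (simp add: gal_group_mult compose_eq)

lemma gal_group_ring_hom:
  "g \<in> carrier (gal_group R (carrier R) E) \<Longrightarrow> g \<in> ring_hom R R"
  by (simp add: carrier_gal_group ring_iso_def)

lemma gal_group_closed:
  "g \<in> carrier (gal_group R (carrier R) E) \<Longrightarrow> x \<in> carrier R \<Longrightarrow> g x \<in> carrier R"
  by (rule ring_hom_closed[OF gal_group_ring_hom])

lemma gal_group_eqI:
  assumes "g \<in> carrier (gal_group R (carrier R) E)" "h \<in> carrier (gal_group R (carrier R) E')"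
    and "\<And>x. x \<in> carrier R \<Longrightarrow> g x = h x"
  shows "g = h"
  using assms by (auto simp: carrier_gal_group intro: extensionalityI)

lemma group_gal_group:
  assumes E: "E \<subseteq> carrier R"
  shows "group (gal_group R (carrier R) E)"
proof -
  let ?B = "BijGroup (carrier R)" and ?H = "carrier (gal_group R (carrier R) E)"
  have Bij: "g \<in> Bij (carrier R)" if "g \<in> ?H" for g
    using that by (simp add: gal_group_def)
  have "subgroup ?H ?B"
  proof (rule subgroup.intro)
    show "?H \<subseteq> carrier ?B"
      using Bij by (auto simp: BijGroup_def)
  next
    fix g h
    assume gh: "g \<in> ?H" "h \<in> ?H"
    have "compose (carrier R) g h \<in> ring_iso R R"
    proof (rule ring_iso_cong)
      show "g \<circ> h \<in> ring_iso R R"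
        using gh by (intro ring_iso_set_trans[of h R R g R]) (simp_all add: carrier_gal_group)
    qed (simp_all add: compose_eq ring_axioms)
    moreover have "\<forall>x\<in>E. compose (carrier R) g h x = x"
      using gh E by (auto simp: carrier_gal_group compose_eq)
    ultimately have "compose (carrier R) g h \<in> ?H"
      unfolding carrier_gal_group by simp
    then show "g \<otimes>\<^bsub>?B\<^esub> h \<in> ?H"
      using gh by (simp add: BijGroup_def Bij)
  next
    have "(\<lambda>x\<in>carrier R. x) \<in> ring_iso R R"
      by (rule ring_iso_cong[OF ring_iso_set_refl]) (simp_all add: ring_axioms)
    then show "\<one>\<^bsub>?B\<^esub> \<in> ?H"
      using E by (auto simp: carrier_gal_group BijGroup_def)
  next
    fix g assume g: "g \<in> ?H"
    then have bij: "bij_betw g (carrier R) (carrier R)"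
      by (auto simp: carrier_gal_group ring_iso_def)
    define h where "h = restrict (inv_into (carrier R) g) (carrier R)"
    have "inv_into (carrier R) g \<in> ring_iso R R"
      using g by (intro ring_iso_set_sym ring_axioms) (simp add: carrier_gal_group)
    then have "h \<in> ring_iso R R"
      by (rule ring_iso_cong) (simp_all add: h_def ring_axioms)
    moreover have "h x = x" if "x \<in> E" for x
    proof -
      have "g x = x" "x \<in> carrier R" using g that E by (auto simp: carrier_gal_group)
      then show ?thesis
        using bij by (metis h_def bij_betw_inv_into_left restrict_apply')
    qed
    ultimately have "h \<in> ?H"
      by (simp add: carrier_gal_group h_def)
    then show "inv\<^bsub>?B\<^esub> g \<in> ?H"
      using inv_BijGroup[OF Bij[OF g]] by (simp add: h_def)
  qed
  then have "group (?B\<lparr>carrier := ?H\<rparr>)"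
    by (rule subgroup.subgroup_is_group) (rule group_BijGroup)
  then show ?thesis
    by (simp add: gal_group_def)
qed

section \<open>Artin's theorem for finite groups of automorphisms\<close>

text \<open>Used to identify the index set of the norm to a fixed field with the group that defines
  this field. The trace argument avoids counting degrees.\<close>

lemma gal_group_fixed_field:
  assumes E: "E \<subseteq> carrier R" and H: "subgroup H (gal_group R (carrier R) E)" and fin: "finite H"
  shows "carrier (gal_group R (carrier R) (fixed_field (carrier R) H)) = H"
proof
  let ?G = "gal_group R (carrier R) E"
  interpret G: group ?G
    using E by (rule group_gal_group)
  have HG: "h \<in> carrier ?G" if "h \<in> H" for h
    using subgroup.subset[OF H] that by blast
  show "H \<subseteq> carrier (gal_group R (carrier R) (fixed_field (carrier R) H))"
    using HG by (auto simp: carrier_gal_group fixed_field_def)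
  show "carrier (gal_group R (carrier R) (fixed_field (carrier R) H)) \<subseteq> H"
  proof (rule subsetI, rule ccontr)
    fix g
    assume g: "g \<in> carrier (gal_group R (carrier R) (fixed_field (carrier R) H))" and "g \<notin> H"
    \<comment> \<open>Places \<open>g\<close> in the same group \<open>?G\<close> as the elements of
      \<open>H\<close>, so that products of them make sense.\<close>
    have "E \<subseteq> fixed_field (carrier R) H"
      using E HG by (auto simp: carrier_gal_group fixed_field_def)
    then have gG: "g \<in> carrier ?G"
      using g by (auto simp: carrier_gal_group)
    have ghom: "g \<in> ring_hom R R"
      using gG by (rule gal_group_ring_hom)
    have hc: "h x \<in> carrier R" if "h \<in> H" "x \<in> carrier R" for h x
      using gal_group_closed HG that by blast
    have gc: "g x \<in> carrier R" if "x \<in> carrier R" for x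
      using gal_group_closed gG that by blast
    \<comment> \<open>Left translation by \<open>h\<close> permutes \<open>H\<close>: it is
      injective and \<open>H\<close> is finite.\<close>
    have trace_fixed: "h (\<Oplus>k\<in>H. k x) = (\<Oplus>k\<in>H. k x)" if h: "h \<in> H" and x: "x \<in> carrier R" for h x
    proof -
      interpret h: ring_hom_cring R R h
        using gal_group_ring_hom[OF HG[OF h]] by unfold_locales
      have inj: "inj_on (\<lambda>k. h \<otimes>\<^bsub>?G\<^esub> k) H"
        using HG h by (auto intro!: inj_onI)
      have "(\<lambda>k. h \<otimes>\<^bsub>?G\<^esub> k) ` H \<subseteq> H"
        using subgroup.m_closed[OF H h] by blast
      then have img: "(\<lambda>k. h \<otimes>\<^bsub>?G\<^esub> k) ` H = H"
        using endo_inj_surj[OF fin _ inj] by blast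
      have "h (\<Oplus>k\<in>H. k x) = (\<Oplus>k\<in>H. h (k x))"
        using hc x by (subst h.hom_finsum) (auto simp: comp_def)
      also have "\<dots> = (\<Oplus>k\<in>H. (h \<otimes>\<^bsub>?G\<^esub> k) x)"
        using HG h x hc by (intro finsum_cong') (auto simp: gal_group_mult_apply)
      also have "\<dots> = (\<Oplus>k\<in>(\<lambda>k. h \<otimes>\<^bsub>?G\<^esub> k) ` H. k x)"
        using hc x img by (intro finsum_reindex[symmetric] inj) auto
      finally show ?thesis
        using img by simp
    qed
    have trace: "(\<Oplus>k\<in>H. g (k x)) = (\<Oplus>k\<in>H. k x)" if x: "x \<in> carrier R" for x
    proof -
      interpret g: ring_hom_cring R R g
        using ghom by unfold_locales
      have "(\<Oplus>k\<in>H. k x) \<in> fixed_field (carrier R) H"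
        using trace_fixed x hc by (auto simp: fixed_field_def intro!: finsum_closed)
      then have "g (\<Oplus>k\<in>H. k x) = (\<Oplus>k\<in>H. k x)"
        using g by (auto simp: carrier_gal_group)
      then show ?thesis
        using hc x by (subst (asm) g.hom_finsum) (auto simp: comp_def)
    qed
    \<comment> \<open>If \<open>g \<notin> H\<close>, the cosets \<open>H\<close> and \<open>gH\<close> are disjoint, so this identity contradicts
      the independence of automorphisms.\<close>
    define f where "f = case_sum (\<lambda>k :: 'a \<Rightarrow> 'a. k) (\<lambda>k x. g (k x))"
    \<comment> \<open>\<open>Inl k\<close> stands for \<open>k\<close> and \<open>Inr k\<close> for
      the element \<open>gk\<close> of the coset. The coefficients below are \<one> on
      \<open>H\<close> and \<ominus> \<one> on \<open>gH\<close>, which expresses that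
      \<open>g\<close> fixes the trace.\<close>
    define S where "S = Inl ` H \<union> Inr ` H"
    define c where "c = case_sum (\<lambda>k :: 'a \<Rightarrow> 'a. \<one>) (\<lambda>k :: 'a \<Rightarrow> 'a. \<ominus> \<one>)"
    have f_hom: "f i \<in> ring_hom R R" if i: "i \<in> S" for i
      using i gal_group_ring_hom[OF HG] ring_hom_trans[OF gal_group_ring_hom[OF HG] ghom]
      by (auto simp: S_def f_def comp_def)
    have g_inj: "k = k'" if k: "k \<in> H" "k' \<in> H" and eq: "\<forall>x\<in>carrier R. g (k x) = g (k' x)" for k k'
    proof -
      have "g \<otimes>\<^bsub>?G\<^esub> k = g \<otimes>\<^bsub>?G\<^esub> k'"
        using eq HG gG k by (intro gal_group_eqI[of _ E _ E]) (auto simp: gal_group_mult_apply)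
      then show ?thesis
        using HG gG k by simp
    qed
    \<comment> \<open>If \<open>gk\<close> were some \<open>k'\<close> in \<open>H\<close>, then
      \<open>g\<close> would be the product of \<open>k'\<close> and the inverse of
      \<open>k\<close>, hence in \<open>H\<close>. This is the disjointness of the two
      cosets.\<close>
    have g_coset: False if k: "k \<in> H" "k' \<in> H" and eq: "\<forall>x\<in>carrier R. g (k x) = k' x" for k k'
    proof -
      have "g \<otimes>\<^bsub>?G\<^esub> k = k'"
        using eq HG gG k by (intro gal_group_eqI[of _ E _ E]) (auto simp: gal_group_mult_apply)
      then have "g = k' \<otimes>\<^bsub>?G\<^esub> inv\<^bsub>?G\<^esub> k"
        using HG gG k G.inv_solve_right by simp
      then show False
        using \<open>g \<notin> H\<close> subgroup.m_closed[OF H k(2) subgroup.m_inv_closed[OF H k(1)]] by simp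
    qed
    have H_ext: "k = k'" if "k \<in> H" "k' \<in> H" "\<forall>x\<in>carrier R. k x = k' x" for k k'
      using that HG by (intro gal_group_eqI[of _ E _ E]) auto
    \<comment> \<open>By definition this coefficient is \<one>, so its vanishing is the
      contradiction.\<close>
    have "c (Inl \<one>\<^bsub>?G\<^esub>) = \<zero>"
    proof (rule dedekind_independence[where S = "S" and f = f])
      show "finite S"
        using fin by (simp add: S_def)
      show "\<exists>x\<in>carrier R. f i x \<noteq> f j x" if "i \<in> S" "j \<in> S" "i \<noteq> j" for i j
      proof (rule ccontr)
        assume "\<not> (\<exists>x\<in>carrier R. f i x \<noteq> f j x)"
        then have "\<forall>x\<in>carrier R. f i x = f j x"
          by blast
        with that show False
          unfolding f_def S_def
          by (elim UnE imageE) (simp_all, use H_ext g_inj g_coset in \<open>metis+\<close>)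
      qed
      show "c \<in> S \<rightarrow> carrier R"
        by (auto simp: c_def split: sum.split)
      show "(\<Oplus>i\<in>S. c i \<otimes> f i x) = \<zero>" if x: "x \<in> carrier R" for x
      proof -
        have cl: "c i \<otimes> f i x \<in> carrier R" if "i \<in> S" for i
          using that hc gc x by (auto simp: S_def c_def f_def)
        have tr: "(\<Oplus>k\<in>H. k x) \<in> carrier R"
          using hc x by (auto intro!: finsum_closed)
        have "(\<Oplus>i\<in>S. c i \<otimes> f i x)
            = (\<Oplus>i\<in>Inl ` H. c i \<otimes> f i x) \<oplus> (\<Oplus>i\<in>Inr ` H. c i \<otimes> f i x)"
          using fin cl unfolding S_def by (intro finsum_Un_disjoint) auto
        also have "(\<Oplus>i\<in>Inl ` H. c i \<otimes> f i x) = (\<Oplus>k\<in>H. c (Inl k) \<otimes> f (Inl k) x)"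
          using cl by (intro finsum_reindex) (auto simp: S_def)
        also have "\<dots> = (\<Oplus>k\<in>H. k x)"
          using hc x by (intro finsum_cong') (auto simp: c_def f_def)
        also have "(\<Oplus>i\<in>Inr ` H. c i \<otimes> f i x) = (\<Oplus>k\<in>H. c (Inr k) \<otimes> f (Inr k) x)"
          using cl by (intro finsum_reindex) (auto simp: S_def)
        also have "\<dots> = (\<Oplus>k\<in>H. \<ominus> \<one> \<otimes> g (k x))"
          using hc gc x by (intro finsum_cong') (auto simp: c_def f_def)
        also have "\<dots> = \<ominus> \<one> \<otimes> (\<Oplus>k\<in>H. g (k x))"
          using fin hc gc x by (intro finsum_rdistr[symmetric]) auto
        also have "\<dots> = \<ominus> \<one> \<otimes> (\<Oplus>k\<in>H. k x)"
          using trace x by simp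
        finally show ?thesis
          using tr by (simp add: l_minus r_neg)
      qed
      show "Inl \<one>\<^bsub>?G\<^esub> \<in> S"
        using subgroup.one_closed[OF H] by (simp add: S_def)
    qed (rule f_hom)
    then show False
      by (simp add: c_def)
  qed
qed

lemma gal_group_pow_Suc_apply:
  assumes E: "E \<subseteq> carrier R" and g: "g \<in> carrier (gal_group R (carrier R) E)" and x: "x \<in> carrier R"
  shows "(g [^]\<^bsub>gal_group R (carrier R) E\<^esub> Suc i) x = g ((g [^]\<^bsub>gal_group R (carrier R) E\<^esub> i) x)"
proof -
  interpret G: group "gal_group R (carrier R) E"
    using E by (rule group_gal_group)
  show ?thesis
    unfolding G.nat_pow_Suc2[OF g] using g G.nat_pow_closed[OF g] x by (rule gal_group_mult_apply)
qed

text \<open>The witness is a nonzero Lagrange resolvent. The conclusion says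
  \<open>x = w / g(w)\<close>, written without division.\<close>

lemma hilbert_90:
  assumes E: "E \<subseteq> carrier R" and g: "g \<in> carrier (gal_group R (carrier R) E)"
    and pos: "0 < card (generate (gal_group R (carrier R) E) {g})"
    and x: "x \<in> carrier R"
    and norm: "(\<Otimes>h \<in> generate (gal_group R (carrier R) E) {g}. h x) = \<one>"
  obtains w where "w \<in> carrier R - {\<zero>}" "x \<otimes> g w = w"
proof -
  let ?G = "gal_group R (carrier R) E"
  interpret G: group ?G
    using E by (rule group_gal_group)
  interpret g: ring_hom_cring R R g
    using gal_group_ring_hom[OF g] by unfold_locales
  \<comment> \<open>An infinite order is recorded as 0, as is the cardinality of an infinite set, so
    \<open>pos\<close> amounts to finite order.\<close>
  define n where "n = G.ord g"
  have n: "0 < n"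
    using pos G.generate_pow_card[OF g] by (simp add: n_def)
  define s where "s i = g [^]\<^bsub>?G\<^esub> (i :: nat)" for i
  have sG: "s i \<in> carrier ?G" for i
    using g by (simp add: s_def)
  have sc: "s i y \<in> carrier R" if "y \<in> carrier R" for i y
    using gal_group_closed[OF sG that] .
  have s0: "s 0 y = y" if "y \<in> carrier R" for y
    using that by (simp add: s_def gal_group_one)
  have sn: "s n y = y" if "y \<in> carrier R" for y
    using that g by (simp add: s_def n_def gal_group_one)
  have sSuc: "s (Suc i) y = g (s i y)" if "y \<in> carrier R" for i y
    unfolding s_def using gal_group_pow_Suc_apply[OF E g that] .
  \<comment> \<open>The facts about \<open>G.ord\<close> use the closed range up to
    \<open>n - 1\<close>; with truncated subtraction the two ranges agree only for positive
    \<open>n\<close>.\<close>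
  have less: "{0..n - 1} = {..<n}"
    using n by auto
  have inj: "inj_on s {..<n}"
    using G.ord_inj[OF g] less unfolding s_def[abs_def] n_def by simp
  have gen: "generate ?G {g} = s ` {..<n}"
    using G.generate_pow_nat[OF g] G.ord_elems_inf_carrier[OF g] n less
    unfolding s_def n_def by auto
  \<comment> \<open>The partial norm \<open>x g(x) ... g^(k-1)(x)\<close>: the empty product \<one>
    for \<open>k = 0\<close>, the full norm for \<open>k = n\<close>.\<close>
  define a where "a k = (\<Otimes>i\<in>{..<k}. s i x)" for k
  have ac: "a k \<in> carrier R" for k
    unfolding a_def using sc x by auto
  have a0: "a 0 = \<one>"
    by (simp add: a_def)
  have "(\<Otimes>h \<in> s ` {..<n}. h x) = a n"
    unfolding a_def using sc x inj by (intro finprod_reindex) auto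
  then have an: "a n = \<one>"
    using norm gen by simp
  \<comment> \<open>Splitting off the first factor leaves the image of \<open>a k\<close> under
    \<open>g\<close>.\<close>
  have aSuc: "a (Suc k) = x \<otimes> g (a k)" for k
  proof -
    have "a (Suc k) = (\<Otimes>i\<in>insert 0 (Suc ` {..<k}). s i x)"
      by (simp add: a_def lessThan_Suc_eq_insert_0)
    also have "\<dots> = s 0 x \<otimes> (\<Otimes>i\<in>Suc ` {..<k}. s i x)"
      using sc x by (intro finprod_insert) auto
    also have "(\<Otimes>i\<in>Suc ` {..<k}. s i x) = (\<Otimes>i\<in>{..<k}. s (Suc i) x)"
      using sc x by (intro finprod_reindex) auto
    also have "\<dots> = (\<Otimes>i\<in>{..<k}. g (s i x))"
      using sc x by (simp add: sSuc)
    also have "\<dots> = g (a k)"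
      unfolding a_def using sc x by (subst g.hom_finprod) (auto simp: comp_def)
    finally show ?thesis
      using s0 x by simp
  qed
  \<comment> \<open>The Lagrange resolvent. Were it zero for all \<open>y\<close>, independence of
    the powers of \<open>g\<close> would force \<open>a 0 = \<zero>\<close>, although
    \<open>a 0 = \<one>\<close>.\<close>
  define \<theta> where "\<theta> y = (\<Oplus>i\<in>{..<n}. a i \<otimes> s i y)" for y
  have \<theta>c: "\<theta> y \<in> carrier R" if "y \<in> carrier R" for y
    unfolding \<theta>_def using ac sc that by (intro finsum_closed) auto
  have "\<exists>y \<in> carrier R. \<theta> y \<noteq> \<zero>"
  proof (rule ccontr)
    assume *: "\<not> ?thesis"
    have "a 0 = \<zero>"
    proof (rule dedekind_independence[where S = "{..<n}" and f = s])
      show "s i \<in> ring_hom R R" for i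
        by (rule gal_group_ring_hom[OF sG])
      show "\<exists>y\<in>carrier R. s i y \<noteq> s j y" if "i \<in> {..<n}" "j \<in> {..<n}" "i \<noteq> j" for i j
        using that inj gal_group_eqI[OF sG sG] by (metis inj_onD)
      show "(\<Oplus>i\<in>{..<n}. a i \<otimes> s i y) = \<zero>" if "y \<in> carrier R" for y
        using * that by (auto simp: \<theta>_def)
    qed (use n ac in auto)
    then show False
      by (simp add: a0)
  qed
  then obtain y where y: "y \<in> carrier R" "\<theta> y \<noteq> \<zero>"
    by blast
  define t where "t i = a i \<otimes> s i y" for i
  have tc: "t i \<in> carrier R" for i
    using ac sc y by (simp add: t_def)
  have tsum: "(\<Oplus>i\<in>B. t (h i)) \<in> carrier R" for B and h :: "nat \<Rightarrow> nat"
    using tc by (intro finsum_closed) auto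
  have "x \<otimes> g (\<theta> y) = x \<otimes> (\<Oplus>i\<in>{..<n}. g (t i))"
    using tc unfolding \<theta>_def t_def[symmetric] by (subst g.hom_finsum) (auto simp: comp_def)
  also have "\<dots> = (\<Oplus>i\<in>{..<n}. x \<otimes> g (t i))"
    using tc x by (intro finsum_rdistr) auto
  also have "\<dots> = (\<Oplus>i\<in>{..<n}. t (Suc i))"
    using tc ac sc x y by (intro finsum_cong') (auto simp: t_def aSuc sSuc m_assoc)
  \<comment> \<open>The shift of the index is cyclic, since \<open>a n = \<one>\<close> and the
    \<open>n\<close>-th power of \<open>g\<close> is the identity give \<open>t n = t 0\<close>.
    Adding \<open>t 0\<close> on both sides turns this into two ways of splitting the sum up to
    \<open>n\<close>.\<close>
  also have "\<dots> = (\<Oplus>i\<in>{..<n}. t i)"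
  proof -
    have "t 0 \<oplus> (\<Oplus>i\<in>{..<n}. t (Suc i)) = t 0 \<oplus> (\<Oplus>i\<in>Suc ` {..<n}. t i)"
      using tc by (subst finsum_reindex) auto
    also have "\<dots> = (\<Oplus>i\<in>{..<Suc n}. t i)"
      unfolding lessThan_Suc_eq_insert_0 using tc by (intro finsum_insert[symmetric]) auto
    also have "\<dots> = t n \<oplus> (\<Oplus>i\<in>{..<n}. t i)"
      unfolding lessThan_Suc using tc by (intro finsum_insert) auto
    also have "t n = t 0"
      using y by (simp add: t_def a0 an s0 sn)
    finally show ?thesis
      using tc tsum[of Suc] tsum[of id] by simp
  qed
  finally have "x \<otimes> g (\<theta> y) = \<theta> y"
    by (simp add: \<theta>_def t_def)
  with \<theta>c y that show ?thesis
    by blast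
qed

section \<open>Norms and automorphisms on the multiplicative group\<close>

lemma galois_norm_eq:
  "galois_norm R (carrier R) E x = (\<Otimes>g\<in>carrier (gal_group R (carrier R) E). g x)"
  by (simp add: galois_norm_def)

lemma galois_norm_closed: "x \<in> carrier R \<Longrightarrow> galois_norm R (carrier R) E x \<in> carrier R"
  unfolding galois_norm_eq by (intro finprod_closed) (auto intro: gal_group_closed)

text \<open>Over an infinite index set \<open>finprod\<close> has the default value \<one>, for
  which the identity holds as well.\<close>

lemma galois_norm_mult:
  assumes "x \<in> carrier R" "y \<in> carrier R"
  shows "galois_norm R (carrier R) E (x \<otimes> y)
    = galois_norm R (carrier R) E x \<otimes> galois_norm R (carrier R) E y"
proof -
  have "galois_norm R (carrier R) E (x \<otimes> y)
      = (\<Otimes>g\<in>carrier (gal_group R (carrier R) E). g x \<otimes> g y)"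
    unfolding galois_norm_eq using assms gal_group_closed
    by (intro finprod_cong') (auto simp: ring_hom_mult[OF gal_group_ring_hom])
  also have "\<dots> = galois_norm R (carrier R) E x \<otimes> galois_norm R (carrier R) E y"
    unfolding galois_norm_eq using assms gal_group_closed by (intro finprod_multf) auto
  finally show ?thesis .
qed

lemma galois_norm_one: "galois_norm R (carrier R) E \<one> = \<one>"
  unfolding galois_norm_eq
  by (intro finprod_one_eqI) (rule ring_hom_one[OF gal_group_ring_hom])

text \<open>A nonzero \<open>x\<close> has nonzero norm because the norms of \<open>x\<close> and
  \<open>inv x\<close> multiply to the norm of \<one>. This makes the norm an endomorphism of an
  abelian group, as the abstract form of the procedure requires.\<close>

lemma galois_norm_hom_units:
  "galois_norm R (carrier R) E \<in> hom (units_of R) (units_of R)"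
proof -
  have "galois_norm R (carrier R) E x \<noteq> \<zero>" if "x \<in> carrier R" "x \<noteq> \<zero>" for x
  proof
    assume *: "galois_norm R (carrier R) E x = \<zero>"
    have "x \<in> Units R"
      using that by (simp add: field_Units)
    then have "galois_norm R (carrier R) E (x \<otimes> inv x) = \<zero>"
      using galois_norm_mult[of x "inv x" E] galois_norm_closed * that by simp
    with \<open>x \<in> Units R\<close> show False
      by (simp add: galois_norm_one)
  qed
  then show ?thesis
    by (auto simp: hom_def units_of_def field_Units galois_norm_closed galois_norm_mult)
qed

text \<open>Right translation by \<open>g\<close> permutes the conjugates. For \<open>N2\<close> and
  \<sigma>2 it shows that the factor \<open>\<sigma>2(w) / w\<close> has norm \<one>.\<close>

lemma galois_norm_gal_group:
  assumes E: "E \<subseteq> carrier R" and g: "g \<in> carrier (gal_group R (carrier R) E)" and x: "x \<in> carrier R"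
  shows "galois_norm R (carrier R) E (g x) = galois_norm R (carrier R) E x"
proof -
  let ?G = "gal_group R (carrier R) E"
  interpret G: group ?G
    using E by (rule group_gal_group)
  have inj: "inj_on (\<lambda>h. h \<otimes>\<^bsub>?G\<^esub> g) (carrier ?G)"
    using g by (auto intro!: inj_onI)
  \<comment> \<open>The group may be infinite here, so surjectivity comes from an explicit preimage
    and not from counting.\<close>
  have img: "(\<lambda>h. h \<otimes>\<^bsub>?G\<^esub> g) ` carrier ?G = carrier ?G"
  proof
    show "carrier ?G \<subseteq> (\<lambda>h. h \<otimes>\<^bsub>?G\<^esub> g) ` carrier ?G"
    proof
      fix h assume "h \<in> carrier ?G"
      then show "h \<in> (\<lambda>h. h \<otimes>\<^bsub>?G\<^esub> g) ` carrier ?G"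
        using g by (intro image_eqI[where x = "h \<otimes>\<^bsub>?G\<^esub> inv\<^bsub>?G\<^esub> g"]) (simp_all add: G.m_assoc)
    qed
  qed (use g in auto)
  have "galois_norm R (carrier R) E (g x) = (\<Otimes>h\<in>carrier ?G. (h \<otimes>\<^bsub>?G\<^esub> g) x)"
    unfolding galois_norm_eq using g x gal_group_closed
    by (intro finprod_cong') (auto simp: gal_group_mult_apply)
  also have "\<dots> = (\<Otimes>h\<in>(\<lambda>h. h \<otimes>\<^bsub>?G\<^esub> g) ` carrier ?G. h x)"
    using x gal_group_closed img by (intro finprod_reindex[symmetric] inj) auto
  finally show ?thesis
    by (simp add: img galois_norm_eq)
qed

lemma gal_group_hom_units:
  assumes "g \<in> carrier (gal_group R (carrier R) E)"
  shows "g \<in> hom (units_of R) (units_of R)"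
proof -
  have "g x \<noteq> \<zero>" if "x \<in> carrier R" "x \<noteq> \<zero>" for x
  proof -
    interpret g: ring_hom_cring R R g
      using gal_group_ring_hom[OF assms] by unfold_locales
    have "inj_on g (carrier R)"
      using assms by (auto simp: carrier_gal_group ring_iso_def bij_betw_def)
    then show ?thesis
      using that g.hom_zero by (metis inj_onD zero_closed)
  qed
  then show ?thesis
    using assms gal_group_closed ring_hom_mult[OF gal_group_ring_hom[OF assms]]
    by (auto simp: hom_def units_of_def field_Units)
qed

end

section \<open>The procedure in an abstract abelian group\<close>

text \<open>Here \<open>p\<close> and \<open>q\<close> are the results of Steps 2 and 3. In the norm
  equation \<open>N2 p\<close> cancels; in the third equation \<open>q\<close> drops out, being
  fixed by \<open>s1\<close>.\<close>

lemma (in comm_group) procedure_solves_system: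
  assumes s1: "s1 \<in> hom G G" and N2: "N2 \<in> hom G G"
    and s2x1: "s2 x1 \<in> carrier G"
    and mem: "u \<in> carrier G" "b2 \<in> carrier G" "x1 \<in> carrier G" "p \<in> carrier G" "q \<in> carrier G"
    and step2: "s1 p \<otimes> inv p = u \<otimes> (x1 \<otimes> inv (s2 x1))"
    and fixed: "s1 q = q" and step3: "N2 q = b2 \<otimes> N2 p"
  shows "N2 (inv p \<otimes> q) = b2"
    and "s2 x1 \<otimes> inv x1 \<otimes> (inv p \<otimes> q \<otimes> inv (s1 (inv p \<otimes> q))) = u"
proof -
  interpret s1: group_hom G G s1
    using s1 by unfold_locales
  interpret N2: group_hom G G N2
    using N2 by unfold_locales
  \<comment> \<open>Inverse pairs are first only collected: \<open>r_inv\<close> is switched off so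
    that both sides reach the same AC normal form before anything cancels.\<close>
  have "N2 (inv p \<otimes> q) = b2 \<otimes> (N2 p \<otimes> inv (N2 p))"
    using mem step3 by (simp add: m_ac del: r_inv Units_r_inv)
  then show "N2 (inv p \<otimes> q) = b2"
    using mem by simp
  have "inv p \<otimes> q \<otimes> inv (s1 (inv p \<otimes> q)) = s1 p \<otimes> inv p \<otimes> (q \<otimes> inv q)"
    using mem fixed by (simp add: inv_mult m_ac del: r_inv Units_r_inv)
  also have "\<dots> = u \<otimes> (x1 \<otimes> inv (s2 x1))"
    using mem step2 s2x1 by simp
  finally have "s2 x1 \<otimes> inv x1 \<otimes> (inv p \<otimes> q \<otimes> inv (s1 (inv p \<otimes> q)))
      = u \<otimes> (x1 \<otimes> inv x1) \<otimes> (s2 x1 \<otimes> inv (s2 x1))"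
    using mem s2x1 by (simp add: m_ac del: r_inv Units_r_inv)
  then show "s2 x1 \<otimes> inv x1 \<otimes> (inv p \<otimes> q \<otimes> inv (s1 (inv p \<otimes> q))) = u"
    using mem s2x1 by simp
qed

text \<open>Given are a solution \<open>y1\<close>, \<open>y2\<close> of the system and an arbitrary
  result \<open>x1\<close> of Step 1; \<open>N1 y1\<close> and \<open>N2 y2\<close> play the roles
  of \<open>b1\<close> and \<open>b2\<close>. Correcting the given solution by \<open>w\<close>
  yields one with first component \<open>x1\<close>.\<close>

lemma (in comm_group) system_solves_procedure:
  assumes s1: "s1 \<in> hom G G" and s2: "s2 \<in> hom G G"
    and N1: "N1 \<in> hom G G" and N2: "N2 \<in> hom G G"
    and comm: "\<forall>x \<in> carrier G. s1 (s2 x) = s2 (s1 x)"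
    and hilbert_90: "\<forall>x \<in> carrier G. N1 x = \<one> \<longrightarrow> (\<exists>w \<in> carrier G. x \<otimes> s1 w = w)"
    and N2_s2: "\<forall>x \<in> carrier G. N2 (s2 x) = N2 x"
    and y: "y1 \<in> carrier G" "y2 \<in> carrier G"
    and u: "s2 y1 \<otimes> inv y1 \<otimes> (y2 \<otimes> inv (s1 y2)) = u"
    and x1: "x1 \<in> carrier G" "N1 x1 = N1 y1"
  shows "\<exists>p \<in> carrier G. s1 p \<otimes> inv p = u \<otimes> (x1 \<otimes> inv (s2 x1))"
    and "\<And>p. p \<in> carrier G \<Longrightarrow> s1 p \<otimes> inv p = u \<otimes> (x1 \<otimes> inv (s2 x1)) \<Longrightarrow>
      \<exists>q \<in> carrier G. s1 q = q \<and> N2 q = N2 y2 \<otimes> N2 p"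
proof -
  interpret s1: group_hom G G s1
    using s1 by unfold_locales
  interpret s2: group_hom G G s2
    using s2 by unfold_locales
  interpret N1: group_hom G G N1
    using N1 by unfold_locales
  interpret N2: group_hom G G N2
    using N2 by unfold_locales
  have "N1 (y1 \<otimes> inv x1) = \<one>"
    using x1 y by simp
  then obtain w where w: "w \<in> carrier G" "y1 \<otimes> inv x1 \<otimes> s1 w = w"
    using bspec[OF hilbert_90, of "y1 \<otimes> inv x1"] x1 y by auto
  have "y1 = x1 \<otimes> (y1 \<otimes> inv x1 \<otimes> s1 w) \<otimes> inv (s1 w)"
  proof -
    have "x1 \<otimes> (y1 \<otimes> inv x1 \<otimes> s1 w) \<otimes> inv (s1 w) = y1 \<otimes> (x1 \<otimes> inv x1) \<otimes> (s1 w \<otimes> inv (s1 w))"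
      using x1 y w(1) by (simp add: m_ac del: r_inv Units_r_inv)
    then show ?thesis
      using x1 y w(1) by simp
  qed
  then have y1: "y1 = x1 \<otimes> w \<otimes> inv (s1 w)"
    using w(2) by simp
  \<comment> \<open>The inverse of the second component \<open>y2 s2(w) / w\<close> of the corrected
    solution. The inverse is taken because Step 4 inverts the result of Step 2: from
    \<open>p = c\<close> and \<open>q = \<one>\<close> it recovers this component.\<close>
  define c where "c = inv (s2 w \<otimes> inv w \<otimes> y2)"
  have c: "c \<in> carrier G"
    using w y by (simp add: c_def)
  have "u \<otimes> (x1 \<otimes> inv (s2 x1))
      = s2 (x1 \<otimes> w \<otimes> inv (s1 w)) \<otimes> inv (x1 \<otimes> w \<otimes> inv (s1 w))
        \<otimes> (y2 \<otimes> inv (s1 y2)) \<otimes> (x1 \<otimes> inv (s2 x1))"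
    unfolding u[symmetric] y1 ..
  also have "\<dots> = (x1 \<otimes> inv x1) \<otimes> (s2 x1 \<otimes> inv (s2 x1))
      \<otimes> (s2 w \<otimes> inv w \<otimes> y2 \<otimes> inv (s2 (s1 w)) \<otimes> s1 w \<otimes> inv (s1 y2))"
    using x1 y w(1) by (simp add: inv_mult m_ac del: r_inv Units_r_inv)
  \<comment> \<open>The factors containing \<open>x1\<close> cancel, and the commutation of
    \<open>s1\<close> and \<open>s2\<close> on \<open>w\<close> matches the rest.\<close>
  also have "\<dots> = s1 c \<otimes> inv c"
    using x1 y w(1) by (simp add: c_def inv_mult comm m_ac)
  finally have sc: "u \<otimes> (x1 \<otimes> inv (s2 x1)) = s1 c \<otimes> inv c" .
  then show "\<exists>p \<in> carrier G. s1 p \<otimes> inv p = u \<otimes> (x1 \<otimes> inv (s2 x1))"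
    using c by auto
  fix p
  assume p: "p \<in> carrier G" and "s1 p \<otimes> inv p = u \<otimes> (x1 \<otimes> inv (s2 x1))"
  then have eq: "s1 p \<otimes> inv p = s1 c \<otimes> inv c"
    using sc by simp
  \<comment> \<open>Prepares the witness \<open>p / c\<close> for Step 3: \<open>p\<close> and
    \<open>c\<close> solve the same equation of Step 2, so their quotient is fixed by
    \<open>s1\<close>.\<close>
  have "s1 p \<otimes> inv p \<otimes> (p \<otimes> inv (s1 c)) = s1 p \<otimes> inv (s1 c) \<otimes> (p \<otimes> inv p)"
    using p c by (simp add: m_ac del: r_inv Units_r_inv)
  then have "s1 (p \<otimes> inv c) = s1 p \<otimes> inv p \<otimes> (p \<otimes> inv (s1 c))"
    using p c by simp
  also have "\<dots> = (s1 c \<otimes> inv (s1 c)) \<otimes> (p \<otimes> inv c)"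
    unfolding eq using p c by (simp add: m_ac del: r_inv Units_r_inv)
  finally have "s1 (p \<otimes> inv c) = p \<otimes> inv c"
    using p c by simp
  moreover have "N2 (inv c) = N2 y2"
    using w(1) y N2_s2 by (simp add: c_def)
  then have "N2 (p \<otimes> inv c) = N2 y2 \<otimes> N2 p"
    using p c y by (simp add: m_comm)
  ultimately show "\<exists>q \<in> carrier G. s1 q = q \<and> N2 q = N2 y2 \<otimes> N2 p"
    using p c by blast
qed

section \<open>From the bicyclic data to the abstract hypotheses\<close>

text \<open>Multiplicativity of the product map on \<open>(1, b)\<close> times \<open>(a, 1)\<close>
  is exactly this identity.\<close>

lemma internal_direct_product_commute:
  assumes G: "group G" and "internal_direct_product G H1 H2" and a: "a \<in> H1" and b: "b \<in> H2"
  shows "a \<otimes>\<^bsub>G\<^esub> b = b \<otimes>\<^bsub>G\<^esub> a"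
proof -
  interpret group G
    by (rule G)
  let ?P = "G\<lparr>carrier := H1\<rparr> \<times>\<times> G\<lparr>carrier := H2\<rparr>"
  have H1: "subgroup H1 G" and H2: "subgroup H2 G"
    and hom: "(\<lambda>(g, h). g \<otimes>\<^bsub>G\<^esub> h) \<in> hom ?P G"
    using assms(2) by (auto simp: internal_direct_product_def iso_def)
  have mem: "(\<one>\<^bsub>G\<^esub>, b) \<in> carrier ?P" "(a, \<one>\<^bsub>G\<^esub>) \<in> carrier ?P"
    using a b subgroup.one_closed[OF H1] subgroup.one_closed[OF H2] by auto
  have "a \<in> carrier G" "b \<in> carrier G"
    using a b subgroup.subset[OF H1] subgroup.subset[OF H2] by auto
  then show ?thesis
    using hom_mult[OF hom mem] by (simp add: DirProd_def)
qed

text \<open>Links \<open>F1\<close>, defined by the generator alone, with Artin's theorem, which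
  concerns the whole group.\<close>

lemma (in field) fixed_field_generate:
  assumes E: "E \<subseteq> carrier R" and g: "g \<in> carrier (gal_group R (carrier R) E)"
  shows "fixed_field (carrier R) (generate (gal_group R (carrier R) E) {g})
    = fixed_field (carrier R) {g}"
proof -
  let ?G = "gal_group R (carrier R) E"
  interpret G: group ?G
    using E by (rule group_gal_group)
  have "h x = x" if "h \<in> generate ?G {g}" and x: "x \<in> carrier R" "g x = x" for h x
    using that(1)
  proof (induction rule: generate.induct)
    case one
    then show ?case
      using x by (simp add: gal_group_one)
  next
    case (incl h)
    then show ?case
      using x by simp
  next
    case (inv h)
    then have "(inv\<^bsub>?G\<^esub> h) x = (inv\<^bsub>?G\<^esub> g \<otimes>\<^bsub>?G\<^esub> g) x"
      using x gal_group_mult_apply[OF G.inv_closed[OF g] g x(1)] by simp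
    then show ?case
      using x g by (simp add: gal_group_one)
  next
    case (eng h k)
    then have "h \<in> carrier ?G" "k \<in> carrier ?G"
      using G.generate_in_carrier[of "{g}"] g by auto
    then show ?case
      using eng x by (simp add: gal_group_mult_apply)
  qed
  then show ?thesis
    by (auto simp: fixed_field_def intro: generate.incl)
qed

lemma (in field) hilbert_90_galois_norm:
  assumes E: "E \<subseteq> carrier R" and g: "g \<in> carrier (gal_group R (carrier R) E)"
    and pos: "0 < card (generate (gal_group R (carrier R) E) {g})"
    and x: "x \<in> carrier R"
    and norm: "galois_norm R (carrier R) (fixed_field (carrier R) {g}) x = \<one>"
  obtains w where "w \<in> carrier R - {\<zero>}" "x \<otimes> g w = w"
proof -
  let ?H = "generate (gal_group R (carrier R) E) {g}"
  have "subgroup ?H (gal_group R (carrier R) E)"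
    using g by (intro group.generate_is_subgroup group_gal_group E) simp
  moreover have "finite ?H"
    using pos by (simp add: card_gt_0_iff)
  ultimately have "carrier (gal_group R (carrier R) (fixed_field (carrier R) {g})) = ?H"
    using gal_group_fixed_field[OF E, of ?H] by (simp add: fixed_field_generate[OF E g])
  then have "(\<Otimes>h\<in>?H. h x) = \<one>"
    using norm by (simp add: galois_norm_eq)
  then show ?thesis
    using hilbert_90[OF E g pos x] that by blast
qed

section \<open>Correctness of the procedure for bicyclic algebras\<close>

theorem mainTheorem1:
  fixes A :: "('a, 'b) ring_scheme" (structure)
    and K F F1 F2 Fx F1x :: "'a set"
    and \<sigma>1 \<sigma>2 N1 N2 :: "'a \<Rightarrow> 'a"
    and n1 n2 :: nat
    and z1 z2 u b1 b2 :: 'a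
    and system :: "'a \<Rightarrow> 'a \<Rightarrow> bool"
    and step1 :: "'a \<Rightarrow> bool"
    and step2 :: "'a \<Rightarrow> 'a \<Rightarrow> bool"
    and step3 :: "'a \<Rightarrow> 'a \<Rightarrow> bool"
    and step4 :: "'a \<Rightarrow> 'a \<Rightarrow> 'a"
  assumes bicyclic: "bicyclic_algebra A K F \<sigma>1 \<sigma>2 n1 n2 z1 z2 u b1 b2"
    and F1: "F1 = fixed_field F {\<sigma>1}"
    and F2: "F2 = fixed_field F {\<sigma>2}"
    and Fx: "Fx = F - {\<zero>}"
    and F1x: "F1x = F1 - {\<zero>}"
    and N1: "N1 = galois_norm A F F1"
    and N2: "N2 = galois_norm A F F2"
    and system: "\<And>x1 x2. system x1 x2 \<longleftrightarrow> x1 \<in> Fx \<and> x2 \<in> Fx \<and> N1 x1 = b1 \<and> N2 x2 = b2 \<and>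
          (\<sigma>2 x1 \<otimes> inv x1) \<otimes> (x2 \<otimes> inv (\<sigma>1 x2)) = u"
    and step1: "\<And>x1. step1 x1 \<longleftrightarrow> x1 \<in> Fx \<and> N1 x1 = b1"
    and step2: "\<And>x1 x2'. step2 x1 x2' \<longleftrightarrow>
          x2' \<in> Fx \<and> \<sigma>1 x2' \<otimes> inv x2' = u \<otimes> (x1 \<otimes> inv (\<sigma>2 x1))"
    and step3: "\<And>x2' x2''. step3 x2' x2'' \<longleftrightarrow> x2'' \<in> F1x \<and> N2 x2'' = b2 \<otimes> N2 x2'"
    and step4: "\<And>x2' x2''. step4 x2' x2'' = inv x2' \<otimes> x2''"
  shows "((\<exists>y1 y2. system y1 y2) \<longrightarrow>
            (\<exists>x1. step1 x1) \<and>
            (\<forall>x1. step1 x1 \<longrightarrow>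
              (\<exists>x2'. step2 x1 x2') \<and>
              (\<forall>x2'. step2 x1 x2' \<longrightarrow>
                (\<exists>x2''. step3 x2' x2'') \<and>
                (\<forall>x2''. step3 x2' x2'' \<longrightarrow> system x1 (step4 x2' x2''))))) \<and>
         (\<forall>x1 x2' x2''. step1 x1 \<longrightarrow> step2 x1 x2' \<longrightarrow> step3 x2' x2'' \<longrightarrow>
            system x1 (step4 x2' x2''))"
proof -
  interpret bicyclic_algebra A K F \<sigma>1 \<sigma>2 n1 n2 z1 z2 u b1 b2
    by (rule bicyclic)
  interpret A: ring A
    using csa by (simp add: central_simple_algebra_def simple_ring_def)
  have F: "subfield F A" and KF: "K \<subseteq> F"
    using galois by (simp_all add: galois_extension_def)
  define R where "R = A\<lparr>carrier := F\<rparr>"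
  interpret R: field R
    unfolding R_def by (rule A.subfield_iff(2)[OF F])
  have R_simps: "carrier R = F" "(\<otimes>\<^bsub>R\<^esub>) = (\<otimes>)" "\<one>\<^bsub>R\<^esub> = \<one>" "\<zero>\<^bsub>R\<^esub> = \<zero>"
    by (simp_all add: R_def)
  have gal_R: "gal_group A F E = gal_group R (carrier R) E" for E
    by (simp add: R_def gal_group_carrier_update)
  have norm_R: "galois_norm A F E = galois_norm R (carrier R) E" for E
    by (simp add: R_def galois_norm_def gal_group_carrier_update fun_eq_iff)
  \<comment> \<open>The abelian group in which the procedure runs, the multiplicative group of
    \<open>F\<close>. Inverses in \<open>M\<close> and in \<open>A\<close> agree by uniqueness of
    inverses.\<close>
  define M where "M = units_of R"
  interpret M: comm_group M
    unfolding M_def by (rule R.units_comm_group)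
  have M_carrier: "carrier M = Fx"
    by (simp add: M_def units_of_carrier R.field_Units Fx R_simps)
  have M_mult: "(\<otimes>\<^bsub>M\<^esub>) = (\<otimes>)"
    by (simp add: M_def units_of_mult R_simps)
  have M_one: "\<one>\<^bsub>M\<^esub> = \<one>"
    by (simp add: M_def units_of_one R_simps)
  have Fx_A: "x \<in> carrier A" if "x \<in> Fx" for x
    using that subfieldE(3)[OF F] by (auto simp: Fx)
  have M_inv: "inv\<^bsub>M\<^esub> x = inv x" if "x \<in> Fx" for x
  proof (rule A.inv_unique')
    show "x \<otimes> inv\<^bsub>M\<^esub> x = \<one>" "inv\<^bsub>M\<^esub> x \<otimes> x = \<one>"
      using M.r_inv[of x] M.l_inv[of x] that unfolding M_carrier M_mult M_one by simp_all
    show "x \<in> carrier A" "inv\<^bsub>M\<^esub> x \<in> carrier A"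
      using that M.inv_closed[of x] Fx_A by (auto simp: M_carrier)
  qed
  have Fx_mult: "x \<otimes> y \<in> Fx" if "x \<in> Fx" "y \<in> Fx" for x y
    using M.m_closed[of x y] that by (simp add: M_carrier M_mult)
  have Fx_inv: "inv x \<in> Fx" if "x \<in> Fx" for x
    using M.inv_closed[of x] that by (simp add: M_carrier M_inv)
  \<comment> \<open>From their definitions by \<open>z1\<close> and \<open>z2\<close>,
    \<open>u\<close> and \<open>b2\<close> are only seen to lie in \<open>A\<close>. This brings
    them into \<open>F\<close> once an equation of Step 2 or 3 is at hand.\<close>
  have Fx_cancel: "a \<in> Fx" if "a \<in> carrier A" "v \<in> Fx" "a \<otimes> v \<in> Fx" for a v
  proof -
    have "v \<otimes> inv v = \<one>"
      using M.r_inv[of v] that by (simp add: M_carrier M_mult M_one M_inv)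
    then have "a \<otimes> v \<otimes> inv v = a"
      using that Fx_A Fx_inv by (simp add: A.m_assoc)
    then show ?thesis
      using Fx_mult[OF that(3) Fx_inv[OF that(2)]] by simp
  qed
  have uA: "u \<in> carrier A" and b2A: "b2 \<in> carrier A"
    using z1_unit z2_unit by (auto simp: u_eq b2_eq)
  have K: "K \<subseteq> carrier R"
    using KF by (simp add: R_simps)
  have s1: "\<sigma>1 \<in> carrier (gal_group R (carrier R) K)" and s2: "\<sigma>2 \<in> carrier (gal_group R (carrier R) K)"
    using \<sigma>1_gal \<sigma>2_gal by (simp_all add: gal_R)
  have hom: "\<sigma>1 \<in> hom M M" "\<sigma>2 \<in> hom M M" "N1 \<in> hom M M" "N2 \<in> hom M M"
    unfolding M_def N1 N2 norm_R
    using R.gal_group_hom_units[OF s1] R.gal_group_hom_units[OF s2] R.galois_norm_hom_units by auto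
  have closed: "\<sigma>1 x \<in> Fx" "\<sigma>2 x \<in> Fx" "N1 x \<in> Fx" "N2 x \<in> Fx" if "x \<in> Fx" for x
    using hom that by (auto simp: hom_def M_carrier)
  have comm: "\<forall>x \<in> carrier M. \<sigma>1 (\<sigma>2 x) = \<sigma>2 (\<sigma>1 x)"
  proof
    fix x assume "x \<in> carrier M"
    have "\<sigma>1 \<otimes>\<^bsub>gal_group A F K\<^esub> \<sigma>2 = \<sigma>2 \<otimes>\<^bsub>gal_group A F K\<^esub> \<sigma>1"
      using R.group_gal_group[OF K]
      by (intro internal_direct_product_commute[OF _ direct_product])
        (auto simp: gal_R intro: generate.incl)
    moreover have "x \<in> carrier R"
      using \<open>x \<in> carrier M\<close> by (simp add: M_carrier Fx R_simps)
    ultimately show "\<sigma>1 (\<sigma>2 x) = \<sigma>2 (\<sigma>1 x)"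
      using R.gal_group_mult_apply[OF s1 s2] R.gal_group_mult_apply[OF s2 s1] by (simp add: gal_R)
  qed
  have hilbert_90: "\<forall>x \<in> carrier M. N1 x = \<one>\<^bsub>M\<^esub> \<longrightarrow> (\<exists>w \<in> carrier M. x \<otimes>\<^bsub>M\<^esub> \<sigma>1 w = w)"
  proof (intro ballI impI)
    fix x assume that: "x \<in> carrier M" "N1 x = \<one>\<^bsub>M\<^esub>"
    show "\<exists>w \<in> carrier M. x \<otimes>\<^bsub>M\<^esub> \<sigma>1 w = w"
    proof (rule R.hilbert_90_galois_norm[OF K s1, of x])
      show "0 < card (generate (gal_group R (carrier R) K) {\<sigma>1})"
        using n1_card n1_pos by (simp add: gal_R)
      show "galois_norm R (carrier R) (fixed_field (carrier R) {\<sigma>1}) x = \<one>\<^bsub>R\<^esub>"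
        using that by (simp add: N1 norm_R F1 M_one R_simps)
    qed (use that in \<open>auto simp: M_carrier M_mult Fx R_simps\<close>)
  qed
  have F2_R: "F2 \<subseteq> carrier R"
    by (auto simp: F2 fixed_field_def R_simps)
  \<comment> \<open>\<sigma>2 fixes \<open>F2\<close> by the definition of \<open>F2\<close>, so it
    is one of the automorphisms over which \<open>N2\<close> runs.\<close>
  have s2_F2: "\<sigma>2 \<in> carrier (gal_group R (carrier R) F2)"
    using s2 by (simp add: R.carrier_gal_group) (simp add: F2 fixed_field_def)
  have N2_s2: "\<forall>x \<in> carrier M. N2 (\<sigma>2 x) = N2 x"
    unfolding N2 norm_R
    by (intro ballI R.galois_norm_gal_group[OF F2_R s2_F2]) (simp add: M_carrier Fx R_simps)
  \<comment> \<open>Translates the membership required in Step 3 into the condition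
    \<open>s1 q = q\<close> of the abstract lemmas.\<close>
  have F1x_iff: "x \<in> F1x \<longleftrightarrow> x \<in> Fx \<and> \<sigma>1 x = x" for x
    by (auto simp: F1x F1 Fx fixed_field_def)
  note to_M = M_carrier M_mult M_inv closed Fx_mult Fx_inv
  have sound: "system x1 (step4 p q)" if "step1 x1" "step2 x1 p" "step3 p q" for x1 p q
  proof -
    have mem: "x1 \<in> Fx" "p \<in> Fx" "q \<in> Fx" and q: "\<sigma>1 q = q" and x1: "N1 x1 = b1"
      and eq2: "\<sigma>1 p \<otimes> inv p = u \<otimes> (x1 \<otimes> inv (\<sigma>2 x1))" and eq3: "N2 q = b2 \<otimes> N2 p"
      using that by (auto simp: step1 step2 step3 F1x_iff)
    have "u \<otimes> (x1 \<otimes> inv (\<sigma>2 x1)) \<in> Fx"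
      using mem by (simp add: to_M flip: eq2)
    then have u: "u \<in> Fx"
      using mem uA by (intro Fx_cancel[of u "x1 \<otimes> inv (\<sigma>2 x1)"]) (simp_all add: to_M)
    have "b2 \<otimes> N2 p \<in> Fx"
      using mem by (simp add: to_M flip: eq3)
    then have b2: "b2 \<in> Fx"
      using mem b2A by (intro Fx_cancel[of b2 "N2 p"]) (simp_all add: to_M)
    show ?thesis
      using M.procedure_solves_system[OF hom(1,4), of \<sigma>2 x1 u b2 p q] mem q x1 eq2 eq3 u b2
      by (simp add: to_M system step4)
  qed
  have complete: "(\<exists>p. step2 x1 p) \<and> (\<forall>p. step2 x1 p \<longrightarrow> (\<exists>q. step3 p q))"
    if "system y1 y2" "step1 x1" for x1 y1 y2
  proof -
    have mem: "x1 \<in> Fx" "y1 \<in> Fx" "y2 \<in> Fx"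
      and eq: "N1 x1 = N1 y1" "N2 y2 = b2" "\<sigma>2 y1 \<otimes> inv y1 \<otimes> (y2 \<otimes> inv (\<sigma>1 y2)) = u"
      using that by (auto simp: system step1)
    have "\<sigma>2 y1 \<otimes>\<^bsub>M\<^esub> inv\<^bsub>M\<^esub> y1 \<otimes>\<^bsub>M\<^esub> (y2 \<otimes>\<^bsub>M\<^esub> inv\<^bsub>M\<^esub> (\<sigma>1 y2)) = u"
      using mem eq by (simp add: to_M)
    note * = M.system_solves_procedure[OF hom comm hilbert_90 N2_s2 _ _ this]
    have "\<exists>p\<in>Fx. \<sigma>1 p \<otimes> inv p = u \<otimes> (x1 \<otimes> inv (\<sigma>2 x1))"
      using *(1)[of x1] mem eq by (auto simp: to_M)
    moreover have "\<exists>q\<in>Fx. \<sigma>1 q = q \<and> N2 q = b2 \<otimes> N2 p"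
      if "p \<in> Fx" "\<sigma>1 p \<otimes> inv p = u \<otimes> (x1 \<otimes> inv (\<sigma>2 x1))" for p
      using *(2)[of x1 p] mem eq that by (auto simp: to_M)
    ultimately show ?thesis
      unfolding step2 step3 F1x_iff by blast
  qed
  \<comment> \<open>Solvability of Step 1 itself is witnessed by the first component of the given
    solution.\<close>
  show ?thesis
    using sound complete system step1 by blast
qed

end
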